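(* Let $X,Y$ be topological spaces and let $f:X\to Y$ be a continuous map. If $\mathrm{secat}(f)=1$, then $\mathrm{cat}(f)=\mathrm{cat}(Y)$.
   Context: A continuous map is null-homotopic if it is (freely) homotopic to a constant map. The category $\mathrm{cat}(f)$ of a continuous map $f:X\to Y$ is the least positive integer $n$ such that $X$ is a union of open subsets $U_1,\dots,U_n$ with each restriction $f_{|U_i}:U_i\to Y$ null-homotopic, and $\infty$ if no such integer exists. The LS category $\mathrm{cat}(Y)$ of a space $Y$ is the least positive integer $k$ such that $Y$ is a union of open subsets $U_1,\dots,U_k$ with each inclusion $U_j\hookrightarrow Y$ null-homotopic, and $\infty$ if no such integer exists. The sectional category $\mathrm{secat}(f)$ is the least positive integer $k$ such that $Y$ is a union of open subsets $U_1,\dots,U_k$ and for each $j$ there is a continuous map $s_j:U_j\to X$ with $f\circ s_j$ homotopic to the inclusion $U_j\hookrightarrow Y$. *)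

theory Defs
  imports "HOL-Analysis.Homotopy" "HOL-Library.Extended_Nat"
begin

text \<open>
  In HOL a constant function on an empty domain is a continuous map into any space, so the map from
  the empty space is null-homotopic even when the codomain is empty.  If the domain is nonempty,
  \<^const>\<open>homotopic_with\<close> forces the constant to lie in the codomain.
\<close>

definition null_homotopic :: "'a topology \<Rightarrow> 'b topology \<Rightarrow> ('a \<Rightarrow> 'b) \<Rightarrow> bool" where
  "null_homotopic X Y f \<longleftrightarrow> (\<exists>c. homotopic_with (\<lambda>_. True) X Y f (\<lambda>_. c))"

definition open_cover_by :: "'a topology \<Rightarrow> ('a set \<Rightarrow> bool) \<Rightarrow> nat \<Rightarrow> bool" where
  "open_cover_by X P n \<longleftrightarrow>
     (\<exists>U :: nat \<Rightarrow> 'a set. (\<forall>i\<in>{1..n}. openin X (U i) \<and> P (U i)) \<and> (\<Union>i\<in>{1..n}. U i) = topspace X)"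

definition least_pos :: "(nat \<Rightarrow> bool) \<Rightarrow> enat" where
  "least_pos Q = (if \<exists>n\<ge>1. Q n then enat (LEAST n. n \<ge> 1 \<and> Q n) else \<infinity>)"

definition cat_map :: "'a topology \<Rightarrow> 'b topology \<Rightarrow> ('a \<Rightarrow> 'b) \<Rightarrow> enat" where
  "cat_map X Y f = least_pos (open_cover_by X (\<lambda>U. null_homotopic (subtopology X U) Y f))"

definition LS_cat :: "'b topology \<Rightarrow> enat" where
  "LS_cat Y = least_pos (open_cover_by Y (\<lambda>U. null_homotopic (subtopology Y U) Y (\<lambda>y. y)))"

definition secat :: "'a topology \<Rightarrow> 'b topology \<Rightarrow> ('a \<Rightarrow> 'b) \<Rightarrow> enat" where
  "secat X Y f = least_pos (open_cover_by Y (\<lambda>U. \<exists>s. continuous_map (subtopology Y U) X s \<and>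
     homotopic_with (\<lambda>_. True) (subtopology Y U) Y (f \<circ> s) (\<lambda>y. y)))"

end

theory Submission imports Defs begin

text \<open>
  Null-homotopic open covers pull back: along \<open>f\<close> from \<open>Y\<close> to \<open>X\<close>, and, when \<open>f \<circ> s\<close> is homotopic
  to the identity of \<open>Y\<close>, along \<open>s\<close> from \<open>X\<close> to \<open>Y\<close>. Hence both categories are the least element
  of the same set of cover sizes.
\<close>

text \<open>Preimages of open sets under \<open>g\<close> are open, and they cover because
  \<open>g\<close> maps into \<open>topspace Y\<close>. The number \<open>n\<close> of sets is kept;
  \<open>PQ\<close> isolates what must be checked on each single set.\<close>

lemma open_cover_by_vimage:
  assumes g: "continuous_map X Y g"
    and cover: "open_cover_by Y P n"
    and PQ: "\<And>U. P U \<Longrightarrow> Q {x \<in> topspace X. g x \<in> U}"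
  shows "open_cover_by X Q n"
proof -
  obtain U where U: "\<And>i. i \<in> {1..n} \<Longrightarrow> openin Y (U i) \<and> P (U i)"
    and UN: "(\<Union>i\<in>{1..n}. U i) = topspace Y"
    using cover unfolding open_cover_by_def by blast
  have "(\<Union>i\<in>{1..n}. {x \<in> topspace X. g x \<in> U i}) = topspace X"
    using UN continuous_map_image_subset_topspace[OF g] by fastforce
  moreover have "\<forall>i\<in>{1..n}. openin X {x \<in> topspace X. g x \<in> U i} \<and> Q {x \<in> topspace X. g x \<in> U i}"
    using U PQ openin_continuous_map_preimage[OF g] by blast
  ultimately show ?thesis
    unfolding open_cover_by_def by (intro exI[of _ "\<lambda>i. {x \<in> topspace X. g x \<in> U i}"] conjI)
qed

text \<open>Precompose the homotopy with \<open>g\<close>, which sends the preimage of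
  \<open>U\<close> into \<open>U\<close>; the constant end stays \<open>c\<close>.\<close>

lemma null_homotopic_vimage:
  assumes g: "continuous_map X Y g"
    and null: "null_homotopic (subtopology Y U) Z h"
  shows "null_homotopic (subtopology X {x \<in> topspace X. g x \<in> U}) Z (h \<circ> g)"
proof -
  obtain c where c: "homotopic_with (\<lambda>_. True) (subtopology Y U) Z h (\<lambda>_. c)"
    using null unfolding null_homotopic_def by blast
  have "continuous_map (subtopology X {x \<in> topspace X. g x \<in> U}) (subtopology Y U) g"
    using g by (auto simp: continuous_map_in_subtopology continuous_map_from_subtopology)
  from homotopic_with_compose_continuous_map_right[OF c this]
  have "homotopic_with (\<lambda>_. True) (subtopology X {x \<in> topspace X. g x \<in> U}) Z (h \<circ> g) (\<lambda>_. c)"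
    by (simp add: comp_def)
  then show ?thesis
    unfolding null_homotopic_def by blast
qed

lemma null_homotopic_homotopic:
  assumes "homotopic_with (\<lambda>_. True) X Y f g" and "null_homotopic X Y f"
  shows "null_homotopic X Y g"
  using assms unfolding null_homotopic_def
  by (meson homotopic_with_sym homotopic_with_trans)

lemma least_pos_eq_1D:
  assumes "least_pos Q = 1"
  shows "Q 1"
proof -
  have ex: "\<exists>n\<ge>1. Q n"
    using assms by (auto simp: least_pos_def split: if_splits)
  then have "(LEAST n. n \<ge> 1 \<and> Q n) = 1"
    using assms by (simp add: least_pos_def one_enat_def)
  with LeastI_ex[OF ex] show ?thesis
    by simp
qed

text \<open>A cover by one open set consists of the whole space, so the local homotopy section is
  global.\<close>

lemma secat_eq_1D:
  assumes "secat X Y f = 1"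
  obtains s where "continuous_map Y X s"
    and "homotopic_with (\<lambda>_. True) Y Y (f \<circ> s) (\<lambda>y. y)"
  using least_pos_eq_1D[OF assms[unfolded secat_def]]
  by (auto simp: open_cover_by_def)

theorem mainTheorem6:
  fixes X :: "'a topology" and Y :: "'b topology" and f :: "'a \<Rightarrow> 'b"
  assumes "continuous_map X Y f"
    and "secat X Y f = 1"
  shows "cat_map X Y f = LS_cat Y"
proof -
  obtain s where s: "continuous_map Y X s"
    and fs: "homotopic_with (\<lambda>_. True) Y Y (f \<circ> s) (\<lambda>y. y)"
    using secat_eq_1D[OF assms(2)] by blast
  have "open_cover_by X (\<lambda>U. null_homotopic (subtopology X U) Y f) n \<longleftrightarrow>
    open_cover_by Y (\<lambda>U. null_homotopic (subtopology Y U) Y (\<lambda>y. y)) n" (is "?X \<longleftrightarrow> ?Y") for n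
  proof
    assume ?X
    then show ?Y
    proof (rule open_cover_by_vimage[OF s])
      fix U
      assume "null_homotopic (subtopology X U) Y f"
      \<comment> \<open>This makes \<open>f \<circ> s\<close> null-homotopic on the preimage;
        \<open>fs\<close>, restricted to it, carries this over to the inclusion.\<close>
      from null_homotopic_vimage[OF s this]
      show "null_homotopic (subtopology Y {y \<in> topspace Y. s y \<in> U}) Y (\<lambda>y. y)"
        by (rule null_homotopic_homotopic[OF homotopic_from_subtopology[OF fs]])
    qed
  next
    assume ?Y
    then show ?X
    proof (rule open_cover_by_vimage[OF assms(1)])
      fix U
      assume "null_homotopic (subtopology Y U) Y (\<lambda>y. y)"
      \<comment> \<open>Here the composite of the identity with \<open>f\<close> is \<open>f\<close>
        itself, so no further homotopy enters.\<close>
      from null_homotopic_vimage[OF assms(1) this]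
      show "null_homotopic (subtopology X {x \<in> topspace X. f x \<in> U}) Y f"
        by (simp add: comp_def)
    qed
  qed
  \<comment> \<open>Equivalence for every \<open>n\<close> makes the two predicates equal, which
    covers the value \<infinity> as well.\<close>
  then show ?thesis
    unfolding cat_map_def LS_cat_def by (intro arg_cong[where f = least_pos] ext)
qed

end
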